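(* Let $\Phi = (\phi_1, \dots, \phi_{11})$ be the collection of eleven column vectors in $\mathbb{C}^4$ where $\phi_k$ is (the transpose of) the $k$-th row of the matrix $$ \Phi^T = \begin{pmatrix} 1 & 0 & 0 & 0 \\ 0 & 1 & 0 & 0 \\ 0 & 0 & 1 & 0 \\ 0 & 0 & 0 & 1 \\ 1 & 9 i & -5-7 i & -6-7 i \\ 1 & 1-i & -5-2 i & -1-8 i \\ 1 & -2+4 i & -4-2 i & 3+8 i \\ 1 & -3+i & 1-8 i & 7-6 i \\ 1 & 3-3 i & -8+7 i & -6-2 i \\ 1 & -3+5 i & 5+6 i & 2 i \\ 1 & -3+8 i & 5-5 i & -6-4 i \end{pmatrix}, $$ where $i=\sqrt{-1}$. Then $\Phi$ defines injective measurements on $\mathbb{C}^4$.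
   Context: A frame is a collection $\Phi = (\phi_1,\dots,\phi_n)$ of (column) vectors spanning $\mathbb{C}^d$. For a vector or matrix $v$, $v^*$ denotes its conjugate transpose (and $v^T$ the transpose without conjugation). The frame $\Phi$ is said to define injective measurements on $\mathbb{C}^d$ if the linear map from $d\times d$ Hermitian matrices to $\mathbb{R}^n$ given by $Q \mapsto (\phi_1^* Q \phi_1, \dots, \phi_n^* Q \phi_n)$ is injective on the set of rank-one Hermitian matrices; that is, if for any two vectors $x, y \in \mathbb{C}^d$ with $\phi_k^* x x^* \phi_k = \phi_k^* y y^* \phi_k$ for all $k = 1, \dots, n$, one has $x x^* = y y^*$. (Here $\phi_k^* x x^*\phi_k = |\langle \phi_k, x\rangle|^2 = |\phi_k^* x|^2$.) *)

theory Defs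
  imports "HOL-Analysis.Analysis"
begin

text \<open>A family of \<open>n\<close> vectors in \<open>\<complex>\<^sup>d\<close> is given as the \<open>d \<times> n\<close> matrix whose columns are the
  vectors.  Spans are complex ones, hence \<open>vec.span\<close>: the plain \<open>span\<close> on this type is the real
  linear span.\<close>

definition is_frame :: "complex^'n^'d \<Rightarrow> bool" where
  "is_frame \<Phi> \<longleftrightarrow> vec.span (columns \<Phi>) = UNIV"

definition outer_self :: "complex^'d \<Rightarrow> complex^'d^'d"  \<comment> \<open>\<open>x x\<^sup>*\<close>\<close> where
  "outer_self x = (\<chi> i j. x $ i * cnj (x $ j))"

definition quad_form :: "complex^'d \<Rightarrow> complex^'d^'d \<Rightarrow> complex"  \<comment> \<open>\<open>v\<^sup>* Q v\<close>\<close> where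
  "quad_form v Q = (\<Sum>i\<in>UNIV. cnj (v $ i) * (Q *v v) $ i)"

lemma quad_form_outer_self:
  "quad_form v (outer_self x) = of_real ((cmod (\<Sum>i\<in>UNIV. cnj (v $ i) * x $ i))\<^sup>2)"
  unfolding quad_form_def outer_self_def matrix_vector_mult_def complex_norm_square
  by (simp add: sum_distrib_left sum_distrib_right algebra_simps)

definition defines_injective_measurements :: "complex^'n^'d \<Rightarrow> bool" where
  "defines_injective_measurements \<Phi> \<longleftrightarrow>
     is_frame \<Phi> \<and>
     (\<forall>x y. (\<forall>k. quad_form (column k \<Phi>) (outer_self x) = quad_form (column k \<Phi>) (outer_self y))
        \<longrightarrow> outer_self x = outer_self y)"

definition Phi_transpose :: "complex^4^11" where
  "Phi_transpose = vector
    [vector [1, 0, 0, 0],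
     vector [0, 1, 0, 0],
     vector [0, 0, 1, 0],
     vector [0, 0, 0, 1],
     vector [1,       9*\<i>, - 5 - 7*\<i>, - 6 - 7*\<i>],
     vector [1,   1 -   \<i>, - 5 - 2*\<i>, - 1 - 8*\<i>],
     vector [1, - 2 + 4*\<i>, - 4 - 2*\<i>,   3 + 8*\<i>],
     vector [1, - 3 +   \<i>,   1 - 8*\<i>,   7 - 6*\<i>],
     vector [1,   3 - 3*\<i>, - 8 + 7*\<i>, - 6 - 2*\<i>],
     vector [1, - 3 + 5*\<i>,   5 + 6*\<i>,       2*\<i>],
     vector [1, - 3 + 8*\<i>,   5 - 5*\<i>, - 6 - 4*\<i>]]"

end

theory Submission
  imports Defs
begin

text \<open>
  Two vectors with equal measurements give a Hermitian matrix \<open>Q = x x\<^sup>* - y y\<^sup>*\<close> of rank at most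
  two with \<open>\<phi>\<^sub>k\<^sup>* Q \<phi>\<^sub>k = 0\<close> for all \<open>k\<close>.  These equations make the diagonal of \<open>Q\<close> vanish and confine
  the twelve real coordinates \<open>Q\<^sub>j\<^sub>k = a\<^sub>j\<^sub>k + \<i> b\<^sub>j\<^sub>k\<close> to a five-dimensional real space, on which the
  \<open>3 \<times> 3\<close> minors are cubic forms.  Instead of an elimination argument we use a
  Positivstellensatz certificate of degree four: a combination of six of these cubics with linear
  coefficients is a positive definite sum of squares of quadratic forms, so \<open>Q = 0\<close>.
\<close>

section \<open>Positivity of a quartic form in five real variables\<close>

text \<open>
  The certificate was found numerically, as the analytic centre of the semidefinite program for the
  Gram matrix, and then rounded: the 15 leading squares are a rounded Cholesky factorization of the
  Gram matrix and the remaining terms are a diagonally dominant error.  The coordinates \<open>p, q, r, t, u\<close>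
  refer to an LLL-reduced basis of the lattice of integer solutions of the linear equations, which
  keeps the coefficients small.
\<close>

lemma sum_of_squares_certificate:
  fixes p q r t u :: real
  assumes "a12 = 53 * q - 136 * r - 66 * t + 91 * u"
    and "b12 = 17 * p + 38 * q + 22 * r + 143 * t - 55 * u"
    and "a13 = 41 * p + 94 * q - 103 * t - 83 * u"
    and "b13 = - 77 * p + 40 * q + 44 * r - 37 * t + 5 * u"
    and "a14 = 30 * p + 10 * q - 46 * r + 122 * t + 208 * u"
    and "b14 = 37 * p + 66 * q + 78 * r - 7 * t + 140 * u"
    and "a23 = - 8 * p - 12 * q + 4 * r - 9 * t - 7 * u"
    and "b23 = - 16 * p + 7 * q + 12 * r + 19 * t + 42 * u"
    and "a24 = 28 * p - 6 * q - 45 * r + 11 * t - 79 * u"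
    and "b24 = - 10 * p + 41 * q + 44 * r - 7 * t + 59 * u"
    and "a34 = 10 * p + 17 * q - 9 * r + 28 * t - 16 * u"
    and "b34 = 4 * p + 26 * q + 16 * r + 29 * t + 35 * u"
    and "2 * ((a23 * a34 - b23 * b34) * a24 + (a23 * b34 + b23 * a34) * b24) = 0"
    and "2 * ((a13 * a34 - b13 * b34) * a14 + (a13 * b34 + b13 * a34) * b14) = 0"
    and "2 * ((a12 * a24 - b12 * b24) * a14 + (a12 * b24 + b12 * a24) * b14) = 0"
    and "a12 * a23 * a34 - a12 * b23 * b34 - b12 * a23 * b34 - b12 * b23 * a34 + a13 * a23 * a24
         - b13 * a23 * b24 + a13 * b23 * b24 + b13 * b23 * a24 - a14 * a23 * a23
         - a14 * b23 * b23 = 0"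
    and "- a12 * a13 * a34 + a12 * b13 * b34 - b12 * a13 * b34 - b12 * b13 * a34 + a13 * a13 * a24
         + b13 * b13 * a24 - a13 * a14 * a23 + a13 * b14 * b23 - b13 * b14 * a23
         - b13 * a14 * b23 = 0"
    and "- a12 * a12 * a34 - b12 * b12 * a34 + a12 * a14 * a23 + a12 * b14 * b23 + b12 * b14 * a23
         - b12 * a14 * b23 + a12 * a13 * a24 - b12 * a13 * b24 + a12 * b13 * b24
         + b12 * b13 * a24 = 0"
  shows "p = 0 \<and> q = 0 \<and> r = 0 \<and> t = 0 \<and> u = 0"
proof -
  \<comment> \<open>After substitution of the parametrization this is a polynomial identity in five
    variables. The leading factor 2 makes all coefficients of the left side even, so an error term
    \<open>c * (m + m')\<^sup>2\<close>, with cross term \<open>2 * c * m * m'\<close>, can have an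
    integer weight \<open>c\<close>. The 15 leading squares correspond to the 15 quadratic
    monomials, each square starting one monomial later.\<close>
  have "2 * ((54 * p - 78 * q - 121 * r + 174 * t + 500 * u)
          * (2 * ((a23 * a34 - b23 * b34) * a24 + (a23 * b34 + b23 * a34) * b24))
        + (14 * p - q - 17 * r + 12 * t + 17 * u)
          * (2 * ((a13 * a34 - b13 * b34) * a14 + (a13 * b34 + b13 * a34) * b14))
        + (- 4 * p + r + t + 11 * u)
          * (2 * ((a12 * a24 - b12 * b24) * a14 + (a12 * b24 + b12 * a24) * b14))
        + (- 58 * p - 3 * q + 128 * r - 18 * t + 67 * u)
          * (a12 * a23 * a34 - a12 * b23 * b34 - b12 * a23 * b34 - b12 * b23 * a34 + a13 * a23 * a24
             - b13 * a23 * b24 + a13 * b23 * b24 + b13 * b23 * a24 - a14 * a23 * a23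
             - a14 * b23 * b23)
        + (26 * p - 16 * q - 22 * r + 25 * t - 14 * u)
          * (- a12 * a13 * a34 + a12 * b13 * b34 - b12 * a13 * b34 - b12 * b13 * a34
             + a13 * a13 * a24 + b13 * b13 * a24 - a13 * a14 * a23 + a13 * b14 * b23
             - b13 * b14 * a23 - b13 * a14 * b23)
        + (6 * p - 3 * q - 7 * r - 8 * t + 3 * u)
          * (- a12 * a12 * a34 - b12 * b12 * a34 + a12 * a14 * a23 + a12 * b14 * b23
             + b12 * b14 * a23 - b12 * a14 * b23 + a12 * a13 * a24 - b12 * a13 * b24
             + a12 * b13 * b24 + b12 * b13 * a24)) =
     (2 * ((1338 * p\<^sup>2 + 648 * p * q - 1451 * p * r + 2671 * p * t - 1229 * p * u
           - 578 * q\<^sup>2 - 612 * q * r - 645 * q * t + 940 * q * u + 411 * r\<^sup>2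
           - 1371 * r * t + 822 * r * u + 329 * t\<^sup>2 - 1049 * t * u - 2091 * u\<^sup>2)\<^sup>2
        + (2760 * p * q - 262 * p * r - 1902 * p * t + 943 * p * u + 689 * q\<^sup>2 - 2971 * q * r
           + 1954 * q * t + 95 * q * u - 78 * r\<^sup>2 + 1057 * r * t + 327 * r * u
           - 2312 * t\<^sup>2 + 3972 * t * u + 1329 * u\<^sup>2)\<^sup>2
        + (1453 * p * r + 1801 * p * t + 1818 * p * u + 76 * q\<^sup>2 + 611 * q * r + 409 * q * t
           + 909 * q * u - 792 * r\<^sup>2 - 1287 * r * t - 1690 * r * u + 147 * t\<^sup>2
           - 2567 * t * u - 533 * u\<^sup>2)\<^sup>2
        + (2621 * p * t + 978 * p * u + 679 * q\<^sup>2 + 1354 * q * r - 694 * q * t + 232 * q * u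
           - 268 * r\<^sup>2 - 2760 * r * t - 1720 * r * u + 1565 * t\<^sup>2 - 3552 * t * u
           + 914 * u\<^sup>2)\<^sup>2
        + (1798 * p * u - 386 * q\<^sup>2 - 944 * q * r - 884 * q * t + 1950 * q * u
           - 277 * r\<^sup>2 - 2181 * r * t - 1485 * r * u - 729 * t\<^sup>2 + 1590 * t * u
           - 83 * u\<^sup>2)\<^sup>2
        + (1217 * q\<^sup>2 + 2421 * q * r + 422 * q * t + 809 * q * u + 694 * r\<^sup>2
           + 1851 * r * t + 1064 * r * u - 301 * t\<^sup>2 - 343 * t * u - 1019 * u\<^sup>2)\<^sup>2
        + (2120 * q * r - 2329 * q * t - 277 * q * u + 812 * r\<^sup>2 + 1753 * r * t
           + 1264 * r * u + 894 * t\<^sup>2 - 1385 * t * u - 2504 * u\<^sup>2)\<^sup>2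
        + (2044 * q * t - 43 * q * u + 334 * r\<^sup>2 + 1145 * r * t + 269 * r * u
           + 97 * t\<^sup>2 + 779 * t * u - 785 * u\<^sup>2)\<^sup>2
        + (3163 * q * u - 326 * r\<^sup>2 - 1343 * r * t + 74 * r * u + 463 * t\<^sup>2
           + 237 * t * u + 1686 * u\<^sup>2)\<^sup>2
        + (417 * r\<^sup>2 + 49 * r * t + 718 * r * u - 2 * t\<^sup>2 + 246 * t * u
           - 1554 * u\<^sup>2)\<^sup>2
        + (1195 * r * t + 675 * r * u - 856 * t\<^sup>2 + 807 * t * u + 990 * u\<^sup>2)\<^sup>2
        + (842 * r * u - 226 * t\<^sup>2 - 389 * t * u + 1678 * u\<^sup>2)\<^sup>2
        + (2097 * t\<^sup>2 - 103 * t * u - 1830 * u\<^sup>2)\<^sup>2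
        + (1898 * t * u + 1089 * u\<^sup>2)\<^sup>2
        + (633 * u\<^sup>2)\<^sup>2)
      + 6051 * (t * u + u\<^sup>2)\<^sup>2 + 5526 * (r\<^sup>2 - r * t)\<^sup>2
      + 4806 * (q\<^sup>2 + q * r)\<^sup>2 + 4033 * (t\<^sup>2 - t * u)\<^sup>2
      + 3828 * (r * u + u\<^sup>2)\<^sup>2 + 3334 * (p * q - q\<^sup>2)\<^sup>2
      + 3078 * (r\<^sup>2 - r * u)\<^sup>2 + 2538 * (p * t - t\<^sup>2)\<^sup>2
      + 2384 * (q * r + r\<^sup>2)\<^sup>2 + 2102 * (r * t - t\<^sup>2)\<^sup>2
      + 1828 * (p * u + u\<^sup>2)\<^sup>2 + 1764 * (q\<^sup>2 - q * t)\<^sup>2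
      + 1426 * (p\<^sup>2 - p * t)\<^sup>2 + 1322 * (p\<^sup>2 + p * r)\<^sup>2
      + 1128 * (p\<^sup>2 + p * q)\<^sup>2 + 972 * (p * r + r\<^sup>2)\<^sup>2
      + 817 * (q * t + t\<^sup>2)\<^sup>2 + 790 * (q * u - u\<^sup>2)\<^sup>2
      + 622 * (q\<^sup>2 - q * u)\<^sup>2 + 62 * (p\<^sup>2 + p * u)\<^sup>2
      + 9407 * (q * r + r * u)\<^sup>2 + 8976 * (p * u + t\<^sup>2)\<^sup>2
      + 8531 * (r\<^sup>2 - t * u)\<^sup>2 + 6421 * (p * q - u\<^sup>2)\<^sup>2
      + 6174 * (p * q + t\<^sup>2)\<^sup>2 + 5837 * (p * r + q\<^sup>2)\<^sup>2
      + 5697 * (p\<^sup>2 + q * t)\<^sup>2 + 5297 * (p * r + r * u)\<^sup>2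
      + 4260 * (q\<^sup>2 + r * t)\<^sup>2 + 3990 * (p * u - t * u)\<^sup>2
      + 3830 * (p * r + r * t)\<^sup>2 + 3509 * (p\<^sup>2 - r * u)\<^sup>2
      + 3249 * (q * u - t * u)\<^sup>2 + 2831 * (p\<^sup>2 - q * u)\<^sup>2
      + 2739 * (q * t - r * t)\<^sup>2 + 2660 * (q * t - q * u)\<^sup>2
      + 2580 * (p * t + r * t)\<^sup>2 + 2351 * (r * t + u\<^sup>2)\<^sup>2
      + 2341 * (p * t - q\<^sup>2)\<^sup>2 + 2269 * (p * r - q * r)\<^sup>2
      + 2103 * (p * t + p * u)\<^sup>2 + 1217 * (p * q + q * u)\<^sup>2
      + 1205 * (p * u + r * u)\<^sup>2 + 1192 * (q * r + u\<^sup>2)\<^sup>2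
      + 800 * (q * r + q * u)\<^sup>2 + 628 * (q * u - t\<^sup>2)\<^sup>2
      + 626 * (p\<^sup>2 + q * r)\<^sup>2 + 219 * (q * t + r\<^sup>2)\<^sup>2
      + 60 * (p\<^sup>2 + r * t)\<^sup>2 + 29 * (r * t - t * u)\<^sup>2
      + 4935 * (p * q - r * t)\<^sup>2 + 4360 * (p * r + t * u)\<^sup>2
      + 3503 * (p * t - q * u)\<^sup>2 + 1351 * (q * t + r * u)\<^sup>2
      + 859 * (p * u - q * r)\<^sup>2 + 27015 * (p * q)\<^sup>2 + 25117 * (p * r)\<^sup>2
      + 28109 * (p * t)\<^sup>2 + 30635 * (p * u)\<^sup>2 + 28173 * (q * r)\<^sup>2
      + 33291 * (q * t)\<^sup>2 + 29332 * (q * u)\<^sup>2 + 27780 * (r * t)\<^sup>2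
      + 27153 * (r * u)\<^sup>2 + 27841 * (t * u)\<^sup>2)
      + (36251 * p^4 + 31576 * q^4 + 31084 * r^4 + 32858 * t^4 + 31613 * u^4)"
    (is "_ = ?R + ?P")
    unfolding assms(1-12) by algebra
  then have "?R + ?P = 0"
    using assms(13-18) by simp
  \<comment> \<open>Definiteness is visible in \<open>?P\<close> alone, which collects the pure
    fourth powers with positive weights; \<open>?R\<close> only has to be nonnegative.\<close>
  moreover have "?R \<ge> 0"
    by (intro add_nonneg_nonneg mult_nonneg_nonneg) simp_all
  moreover have "p^4 \<ge> 0" "q^4 \<ge> 0" "r^4 \<ge> 0" "t^4 \<ge> 0" "u^4 \<ge> 0"
    by simp_all
  ultimately have "p^4 = 0" "q^4 = 0" "r^4 = 0" "t^4 = 0" "u^4 = 0"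
    by linarith+
  then show ?thesis
    by simp
qed

section \<open>Integer parametrization of the linear equations\<close>

text \<open>The seven equations reduce twelve unknowns to the five parameters of the certificate,
  which then forces the parameters to vanish.\<close>

lemma linear_cubic_system:
  fixes a12 b12 a13 b13 a14 b14 a23 b23 a24 b24 a34 b34 :: real
  assumes linear: "- 9 * b12 - 5 * a13 + 7 * b13 - 6 * a14 + 7 * b14 - 63 * a23 - 45 * b23 - 63 * a24 - 54 * b24
     + 79 * a34 + 7 * b34 = 0"
    "a12 + b12 - 5 * a13 + 2 * b13 - a14 + 8 * b14 - 3 * a23 + 7 * b23 + 7 * a24 + 9 * b24
     + 21 * a34 - 38 * b34 = 0"
    "- 2 * a12 - 4 * b12 - 4 * a13 + 2 * b13 + 3 * a14 - 8 * b14 - 20 * b23 + 26 * a24 + 28 * b24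
     - 28 * a34 + 26 * b34 = 0"
    "- 3 * a12 - b12 + a13 + 8 * b13 + 7 * a14 + 6 * b14 - 11 * a23 - 23 * b23 - 27 * a24 - 11 * b24
     + 55 * a34 - 50 * b34 = 0"
    "3 * a12 + 3 * b12 - 8 * a13 - 7 * b13 - 6 * a14 + 2 * b14 - 45 * a23 + 3 * b23 - 12 * a24
     + 24 * b24 + 34 * a34 - 58 * b34 = 0"
    "- 3 * a12 - 5 * b12 + 5 * a13 - 6 * b13 - 2 * b14 + 15 * a23 + 43 * b23 + 10 * a24 + 6 * b24
     + 12 * a34 - 10 * b34 = 0"
    "- 3 * a12 - 8 * b12 + 5 * a13 + 5 * b13 - 6 * a14 + 4 * b14 - 55 * a23 + 25 * b23 - 14 * a24
     - 60 * b24 - 10 * a34 + 50 * b34 = 0"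
    and cubic: "2 * ((a23 * a34 - b23 * b34) * a24 + (a23 * b34 + b23 * a34) * b24) = 0"
    "2 * ((a13 * a34 - b13 * b34) * a14 + (a13 * b34 + b13 * a34) * b14) = 0"
    "2 * ((a12 * a24 - b12 * b24) * a14 + (a12 * b24 + b12 * a24) * b14) = 0"
    "a12 * a23 * a34 - a12 * b23 * b34 - b12 * a23 * b34 - b12 * b23 * a34 + a13 * a23 * a24
     - b13 * a23 * b24 + a13 * b23 * b24 + b13 * b23 * a24 - a14 * a23 * a23 - a14 * b23 * b23 = 0"
    "- a12 * a13 * a34 + a12 * b13 * b34 - b12 * a13 * b34 - b12 * b13 * a34 + a13 * a13 * a24
     + b13 * b13 * a24 - a13 * a14 * a23 + a13 * b14 * b23 - b13 * b14 * a23 - b13 * a14 * b23 = 0"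
    "- a12 * a12 * a34 - b12 * b12 * a34 + a12 * a14 * a23 + a12 * b14 * b23 + b12 * b14 * a23
     - b12 * a14 * b23 + a12 * a13 * a24 - b12 * a13 * b24 + a12 * b13 * b24 + b12 * b13 * a24 = 0"
  shows "a12 = 0 \<and> b12 = 0 \<and> a13 = 0 \<and> b13 = 0 \<and> a14 = 0 \<and> b14 = 0
    \<and> a23 = 0 \<and> b23 = 0 \<and> a24 = 0 \<and> b24 = 0 \<and> a34 = 0 \<and> b34 = 0"
proof -
  \<comment> \<open>an integer left inverse of the parametrization in \<open>sum_of_squares_certificate\<close>\<close>
  define p where "p = - 6 * b12 - 5 * a13 + 3 * b13 - 2 * a14 + 5 * b14 + 19 * a23 + b23 + 14 * a24 + b24
    + 16 * a34 + 10 * b34"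
  define q where "q = - 7 * a12 - 7 * b12 + 10 * a13 - 3 * b13 + 7 * a14 - 14 * b14 - 11 * a23 + 3 * b23
    - 12 * a24 + b24 + 4 * a34 + 13 * b34"
  define r where "r = - 3 * a12 - 2 * b12 + 9 * b13 + 5 * a14 + 7 * b14 + 6 * a23 + 6 * b23 + 17 * a24 - 3 * b24
    + 2 * a34 - 16 * b34"
  define t where "t = - 2 * a12 - b12 - 3 * a13 + 13 * b13 + 5 * a14 + 11 * b14 + 3 * a23 - 8 * b23 + 15 * a24
    - 7 * b24 + 7 * a34 - 20 * b34"
  define u where "u = 4 * a12 - 4 * b12 - 7 * a13 - 6 * b13 - 11 * a14 + 3 * b14 - 9 * a23 + 6 * b23 - 8 * a24
    - 6 * b24 + 24 * a34 + 15 * b34"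
  \<comment> \<open>Parametrization after left inverse is the identity on the solution space, so
    each equality is an integer linear identity modulo the seven equations. An integer left inverse
    exists because a basis of all integer solutions extends to a basis of the full integer
    lattice.\<close>
  have param: "a12 = 53 * q - 136 * r - 66 * t + 91 * u"
    "b12 = 17 * p + 38 * q + 22 * r + 143 * t - 55 * u"
    "a13 = 41 * p + 94 * q - 103 * t - 83 * u"
    "b13 = - 77 * p + 40 * q + 44 * r - 37 * t + 5 * u"
    "a14 = 30 * p + 10 * q - 46 * r + 122 * t + 208 * u"
    "b14 = 37 * p + 66 * q + 78 * r - 7 * t + 140 * u"
    "a23 = - 8 * p - 12 * q + 4 * r - 9 * t - 7 * u"
    "b23 = - 16 * p + 7 * q + 12 * r + 19 * t + 42 * u"
    "a24 = 28 * p - 6 * q - 45 * r + 11 * t - 79 * u"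
    "b24 = - 10 * p + 41 * q + 44 * r - 7 * t + 59 * u"
    "a34 = 10 * p + 17 * q - 9 * r + 28 * t - 16 * u"
    "b34 = 4 * p + 26 * q + 16 * r + 29 * t + 35 * u"
    using linear unfolding p_def q_def r_def t_def u_def by algebra+
  have "p = 0 \<and> q = 0 \<and> r = 0 \<and> t = 0 \<and> u = 0"
    by (rule sum_of_squares_certificate[OF param cubic])
  then show ?thesis
    by (simp add: param)
qed

section \<open>Minors of a difference of two rank-one matrices\<close>

text \<open>Such a matrix has rank at most two. The expression expands, along row \<open>i\<close>,
  the minor with rows \<open>i\<close>, \<open>j\<close>, \<open>k\<close> and columns
  \<open>l\<close>, \<open>m\<close>, \<open>n\<close>. Taking \<open>u\<close> and \<open>v\<close>
  independent of \<open>x\<close> and \<open>y\<close> keeps conjugation out of the polynomial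
  identity.\<close>

lemma rank_two_minor:
  fixes x u y v :: "'i \<Rightarrow> 'a::comm_ring_1"
  assumes "\<And>i j. Q i j = x i * u j - y i * v j"
  shows "Q i l * (Q j m * Q k n - Q j n * Q k m) - Q i m * (Q j l * Q k n - Q j n * Q k l)
       + Q i n * (Q j l * Q k m - Q j m * Q k l) = 0"
  unfolding assms by (simp add: algebra_simps)

section \<open>Entries of the matrix and the frame property\<close>

lemma vector_4:
  "(vector [a, b, c, d] :: 'a::zero^4) $ 1 = a"
  "(vector [a, b, c, d] :: 'a::zero^4) $ 2 = b"
  "(vector [a, b, c, d] :: 'a::zero^4) $ 3 = c"
  "(vector [a, b, c, d] :: 'a::zero^4) $ 4 = d"
  unfolding vector_def by simp_all

lemma Phi_transpose_nth:
  "Phi_transpose $ 1 = vector [1, 0, 0, 0]"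
  "Phi_transpose $ 2 = vector [0, 1, 0, 0]"
  "Phi_transpose $ 3 = vector [0, 0, 1, 0]"
  "Phi_transpose $ 4 = vector [0, 0, 0, 1]"
  "Phi_transpose $ 5 = vector [1, 9*\<i>, - 5 - 7*\<i>, - 6 - 7*\<i>]"
  "Phi_transpose $ 6 = vector [1, 1 - \<i>, - 5 - 2*\<i>, - 1 - 8*\<i>]"
  "Phi_transpose $ 7 = vector [1, - 2 + 4*\<i>, - 4 - 2*\<i>, 3 + 8*\<i>]"
  "Phi_transpose $ 8 = vector [1, - 3 + \<i>, 1 - 8*\<i>, 7 - 6*\<i>]"
  "Phi_transpose $ 9 = vector [1, 3 - 3*\<i>, - 8 + 7*\<i>, - 6 - 2*\<i>]"
  "Phi_transpose $ 10 = vector [1, - 3 + 5*\<i>, 5 + 6*\<i>, 2*\<i>]"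
  "Phi_transpose $ 11 = vector [1, - 3 + 8*\<i>, 5 - 5*\<i>, - 6 - 4*\<i>]"
  unfolding Phi_transpose_def vector_def by simp_all

lemma column_transpose_Phi_transpose: "column k (transpose Phi_transpose) = Phi_transpose $ k"
  by (simp add: column_def transpose_def vec_eq_iff)

text \<open>The first four vectors are the standard basis.\<close>

lemma is_frame_Phi: "is_frame (transpose Phi_transpose)"
proof -
  let ?C = "columns (transpose Phi_transpose)"
  have col: "Phi_transpose $ k \<in> ?C" for k
    unfolding columns_def column_transpose_Phi_transpose[symmetric] by blast
  have ax: "Phi_transpose $ 1 = axis 1 1" "Phi_transpose $ 2 = axis 2 1"
    "Phi_transpose $ 3 = axis 3 1" "Phi_transpose $ 4 = axis 4 1"
    by (simp_all add: Phi_transpose_nth vec_eq_iff forall_4 vector_4 axis_def)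
  have "axis i 1 \<in> ?C" for i :: 4
    using exhaust_4[of i] col ax by metis
  then have "(\<Sum>i\<in>UNIV. (x $ i) *s axis i 1) \<in> vec.span ?C" for x :: "complex^4"
    by (intro vec.span_sum vec.span_scale vec.span_base)
  then show ?thesis
    unfolding is_frame_def basis_expansion by blast
qed

section \<open>Hermitian matrices annihilated by the eleven forms\<close>

lemma quad_form_diff: "quad_form v (A - B) = quad_form v A - quad_form v B"
  by (simp add: quad_form_def matrix_vector_mult_diff_rdistrib right_diff_distrib sum_subtractf)

lemma hermitian_eq_0:
  fixes Q :: "complex^4^4"
  assumes herm: "\<And>i j. Q $ j $ i = cnj (Q $ i $ j)"
    and minor: "\<And>i j k l m n.
       Q$i$l * (Q$j$m * Q$k$n - Q$j$n * Q$k$m) - Q$i$m * (Q$j$l * Q$k$n - Q$j$n * Q$k$l)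
       + Q$i$n * (Q$j$l * Q$k$m - Q$j$m * Q$k$l) = 0"
    and form: "\<And>k. quad_form (Phi_transpose $ k) Q = 0"
  shows "Q = 0"
proof -
  note expand = quad_form_def matrix_vector_mult_def sum_4 Phi_transpose_nth vector_4
  \<comment> \<open>The form at a standard basis vector reads off a diagonal entry.\<close>
  have diag: "Q$1$1 = 0" "Q$2$2 = 0" "Q$3$3 = 0" "Q$4$4 = 0"
    using form[of 1] form[of 2] form[of 3] form[of 4] by (simp_all add: expand)
  have lower: "Q$2$1 = cnj (Q$1$2)" "Q$3$1 = cnj (Q$1$3)" "Q$4$1 = cnj (Q$1$4)"
    "Q$3$2 = cnj (Q$2$3)" "Q$4$2 = cnj (Q$2$4)" "Q$4$3 = cnj (Q$3$4)"
    by (rule herm)+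
  define a12 b12 where "a12 = Re (Q$1$2)" and "b12 = Im (Q$1$2)"
  define a13 b13 where "a13 = Re (Q$1$3)" and "b13 = Im (Q$1$3)"
  define a14 b14 where "a14 = Re (Q$1$4)" and "b14 = Im (Q$1$4)"
  define a23 b23 where "a23 = Re (Q$2$3)" and "b23 = Im (Q$2$3)"
  define a24 b24 where "a24 = Re (Q$2$4)" and "b24 = Im (Q$2$4)"
  define a34 b34 where "a34 = Re (Q$3$4)" and "b34 = Im (Q$3$4)"
  note defs = a12_def b12_def a13_def b13_def a14_def b14_def
    a23_def b23_def a24_def b24_def a34_def b34_def
  \<comment> \<open>With zero diagonal the form at \<open>v\<close> is twice the real part of the
    sum of \<open>cnj (v $ i) * Q $ i $ j * v $ j\<close> over \<open>i < j\<close>; the equations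
    are the halves of these.\<close>
  have linear:
    "- 9 * b12 - 5 * a13 + 7 * b13 - 6 * a14 + 7 * b14 - 63 * a23 - 45 * b23 - 63 * a24 - 54 * b24
     + 79 * a34 + 7 * b34 = 0"
    "a12 + b12 - 5 * a13 + 2 * b13 - a14 + 8 * b14 - 3 * a23 + 7 * b23 + 7 * a24 + 9 * b24
     + 21 * a34 - 38 * b34 = 0"
    "- 2 * a12 - 4 * b12 - 4 * a13 + 2 * b13 + 3 * a14 - 8 * b14 - 20 * b23 + 26 * a24 + 28 * b24
     - 28 * a34 + 26 * b34 = 0"
    "- 3 * a12 - b12 + a13 + 8 * b13 + 7 * a14 + 6 * b14 - 11 * a23 - 23 * b23 - 27 * a24 - 11 * b24
     + 55 * a34 - 50 * b34 = 0"
    "3 * a12 + 3 * b12 - 8 * a13 - 7 * b13 - 6 * a14 + 2 * b14 - 45 * a23 + 3 * b23 - 12 * a24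
     + 24 * b24 + 34 * a34 - 58 * b34 = 0"
    "- 3 * a12 - 5 * b12 + 5 * a13 - 6 * b13 - 2 * b14 + 15 * a23 + 43 * b23 + 10 * a24 + 6 * b24
     + 12 * a34 - 10 * b34 = 0"
    "- 3 * a12 - 8 * b12 + 5 * a13 + 5 * b13 - 6 * a14 + 4 * b14 - 55 * a23 + 25 * b23 - 14 * a24
     - 60 * b24 - 10 * a34 + 50 * b34 = 0"
    using form[of 5] form[of 6] form[of 7] form[of 8] form[of 9] form[of 10] form[of 11]
    by (auto simp: expand diag lower complex_eq_iff defs algebra_simps)
  \<comment> \<open>the indices in \<open>minor[of \<dots>]\<close> alternate between rows and columns: \<open>i, l, j, m, k, n\<close>\<close>
  note cubic_simps = diag lower defs algebra_simps
  have cubic1: "2 * ((a23 * a34 - b23 * b34) * a24 + (a23 * b34 + b23 * a34) * b24) = 0"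
    using arg_cong[OF minor[of 2 2 3 3 4 4], of Re]
    by (simp add: cubic_simps)
  have cubic2: "2 * ((a13 * a34 - b13 * b34) * a14 + (a13 * b34 + b13 * a34) * b14) = 0"
    using arg_cong[OF minor[of 1 1 3 3 4 4], of Re]
    by (simp add: cubic_simps)
  have cubic3: "2 * ((a12 * a24 - b12 * b24) * a14 + (a12 * b24 + b12 * a24) * b14) = 0"
    using arg_cong[OF minor[of 1 1 2 2 4 4], of Re]
    by (simp add: cubic_simps)
  \<comment> \<open>The three minors above are principal, hence real. The next three have columns 1,
    2, 3 and rows 2, 3, 4, then 1, 3, 4, then 1, 2, 4; they are complex, and their real parts enter
    the certificate.\<close>
  have cubic4: "a12 * a23 * a34 - a12 * b23 * b34 - b12 * a23 * b34 - b12 * b23 * a34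
                + a13 * a23 * a24 - b13 * a23 * b24 + a13 * b23 * b24 + b13 * b23 * a24
                - a14 * a23 * a23 - a14 * b23 * b23 = 0"
    using arg_cong[OF minor[of 2 1 3 2 4 3], of Re]
    by (simp add: cubic_simps)
  have cubic5: "- a12 * a13 * a34 + a12 * b13 * b34 - b12 * a13 * b34 - b12 * b13 * a34
                + a13 * a13 * a24 + b13 * b13 * a24 - a13 * a14 * a23 + a13 * b14 * b23
                - b13 * b14 * a23 - b13 * a14 * b23 = 0"
    using arg_cong[OF minor[of 1 1 3 2 4 3], of Re]
    by (simp add: cubic_simps)
  have cubic6: "- a12 * a12 * a34 - b12 * b12 * a34 + a12 * a14 * a23 + a12 * b14 * b23
                + b12 * b14 * a23 - b12 * a14 * b23 + a12 * a13 * a24 - b12 * a13 * b24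
                + a12 * b13 * b24 + b12 * b13 * a24 = 0"
    using arg_cong[OF minor[of 1 1 2 2 4 3], of Re]
    by (simp add: cubic_simps)
  have "a12 = 0 \<and> b12 = 0 \<and> a13 = 0 \<and> b13 = 0 \<and> a14 = 0 \<and> b14 = 0
    \<and> a23 = 0 \<and> b23 = 0 \<and> a24 = 0 \<and> b24 = 0 \<and> a34 = 0 \<and> b34 = 0"
    by (rule linear_cubic_system[OF linear cubic1 cubic2 cubic3 cubic4 cubic5 cubic6])
  then have "Q$1$2 = 0" "Q$1$3 = 0" "Q$1$4 = 0" "Q$2$3 = 0" "Q$2$4 = 0" "Q$3$4 = 0"
    by (simp_all add: defs complex_eq_iff)
  then show ?thesis
    by (simp add: vec_eq_iff forall_4 diag lower)
qed

section \<open>Injectivity of the measurements\<close>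

theorem theorem1:
  shows "defines_injective_measurements (transpose Phi_transpose)"
  unfolding defines_injective_measurements_def
proof (intro conjI allI impI is_frame_Phi)
  fix x y :: "complex^4"
  assume eq: "\<forall>k. quad_form (column k (transpose Phi_transpose)) (outer_self x) =
    quad_form (column k (transpose Phi_transpose)) (outer_self y)"
  \<comment> \<open>The form is linear in the matrix, so equal measurements mean that it vanishes on
    the difference.\<close>
  have "outer_self x - outer_self y = 0"
  proof (rule hermitian_eq_0)
    show "quad_form (Phi_transpose $ k) (outer_self x - outer_self y) = 0" for k
      using eq[rule_format, of k] unfolding quad_form_diff column_transpose_Phi_transpose by simp
  next
    fix i j k l m n
    let ?Q = "outer_self x - outer_self y"
    show "?Q $ j $ i = cnj (?Q $ i $ j)"
      by (simp add: outer_self_def mult.commute)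
    show "?Q$i$l * (?Q$j$m * ?Q$k$n - ?Q$j$n * ?Q$k$m) - ?Q$i$m * (?Q$j$l * ?Q$k$n - ?Q$j$n * ?Q$k$l)
       + ?Q$i$n * (?Q$j$l * ?Q$k$m - ?Q$j$m * ?Q$k$l) = 0"
      by (rule rank_two_minor[where x = "($) x" and u = "\<lambda>j. cnj (x $ j)"
            and y = "($) y" and v = "\<lambda>j. cnj (y $ j)"])
        (simp add: outer_self_def)
  qed
  then show "outer_self x = outer_self y"
    by simp
qed

end
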